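(* Let $d\ge1$, $(x,\Phi)\in D([0,\infty),\mathbb{R}^d)\times\mathcal{H}$ with $\mathcal{H}=C([0,\infty)\times\mathbb{R}^d,\mathbb{R})$, and set $y(t):=\Phi(t,x(t))$ and $\tau:=\tau(x,\Phi)$, where for any $(x',\Phi')\in D([0,\infty),\mathbb{R}^d)\times\mathcal{H}$ one defines $\tau(x',\Phi'):=\inf\{t\ge0:\Phi'(t,x'(t))\ge0\}\in[0,\infty]$. 1. Suppose $\tau<\infty$ and it is not the case that $\sup_{s\in[\tau,\tau+\varepsilon]}y(s)>0$ for every $\varepsilon>0$. Then the map $(x',\Phi')\mapsto\tau(x',\Phi')$ from $D([0,\infty),\mathbb{R}^d)\times\mathcal{H}$ (product topology) to $[0,\infty]$ is discontinuous at $(x,\Phi)$. 2. Suppose $\tau=\infty$ and there exists $T>0$ with $\sup_{s\in[0,T]}y(s)=0$. Then the map $(x',\Phi')\mapsto\tau(x',\Phi')$ is discontinuous at $(x,\Phi)$.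
   Context: $D([0,\infty),\mathbb{R}^d)$ is the space of càdlàg paths, with the local $J_1$ topology: the coarsest topology making all restriction maps to $D([0,T],\mathbb{R}^d)$ (with the Skorokhod $J_1$ topology), $T>0$, continuous. $\mathcal{H}$ carries the topology of uniform convergence on compact subsets of $[0,\infty)\times\mathbb{R}^d$. Convention: $\inf\varnothing=\infty$. *)

theory Defs
  imports "HOL-Analysis.Analysis"
begin

section \<open>Cadlag paths\<close>

text \<open>
  One definition covers both \<open>I = {0..}\<close> and \<open>I = {0..T}\<close>: one-sided limits that make no sense at
  an endpoint of \<open>I\<close> are taken along the filter \<^term>\<open>bot\<close>, and are therefore no condition.
\<close>

definition cadlag_on :: "real set \<Rightarrow> (real \<Rightarrow> 'a::metric_space) \<Rightarrow> bool" where
  "cadlag_on I x \<longleftrightarrow>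
     (\<forall>t\<in>I. (x \<longlongrightarrow> x t) (at t within I \<inter> {t<..}) \<and>
            (\<exists>l. (x \<longlongrightarrow> l) (at t within I \<inter> {..<t})))"

text \<open>
  Functions on a subset of the reals are represented by total functions that are \<open>undefined\<close>
  outside the subset, so that distinct elements of the carrier are distinct paths.
\<close>

definition cadlag_paths :: "real set \<Rightarrow> (real \<Rightarrow> 'a::metric_space) set" where
  "cadlag_paths I = {x \<in> extensional I. cadlag_on I x}"

section \<open>The Skorokhod J1 topology on a compact interval\<close>

definition time_changes :: "real \<Rightarrow> (real \<Rightarrow> real) set" where
  "time_changes T =
     {l. strict_mono_on {0..T} l \<and> (\<exists>g. homeomorphism {0..T} {0..T} l g)}"

definition J1_cost ::
  "real \<Rightarrow> (real \<Rightarrow> 'a::metric_space) \<Rightarrow> (real \<Rightarrow> 'a) \<Rightarrow> (real \<Rightarrow> real) \<Rightarrow> real" where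
  "J1_cost T x y l =
     max (SUP t\<in>{0..T}. \<bar>l t - t\<bar>) (SUP t\<in>{0..T}. dist (x t) (y (l t)))"

definition J1_dist :: "real \<Rightarrow> (real \<Rightarrow> 'a::metric_space) \<Rightarrow> (real \<Rightarrow> 'a) \<Rightarrow> real" where
  "J1_dist T x y = (INF l\<in>time_changes T. J1_cost T x y l)"

definition J1_topology :: "real \<Rightarrow> (real \<Rightarrow> 'a::metric_space) topology" where
  "J1_topology T = Metric_space.mtopology (cadlag_paths {0..T}) (J1_dist T)"

section \<open>The local J1 topology\<close>

definition local_J1_topology :: "(real \<Rightarrow> 'a::metric_space) topology" where
  "local_J1_topology =
     topology_generated_by
       {{x \<in> cadlag_paths {0..}. restrict x {0..T} \<in> U} | T U. 0 < T \<and> openin (J1_topology T) U}"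

section \<open>Continuous functions with uniform convergence on compact sets\<close>

definition cont_funs :: "(real \<times> 'a::metric_space \<Rightarrow> real) set" where
  "cont_funs = {F \<in> extensional ({0..} \<times> UNIV). continuous_on ({0..} \<times> UNIV) F}"

definition ucc_topology :: "(real \<times> 'a::metric_space \<Rightarrow> real) topology" where
  "ucc_topology =
     topology_generated_by
       {{G \<in> cont_funs. \<forall>p\<in>K. \<bar>G p - F p\<bar> < e} | F K e.
          F \<in> cont_funs \<and> compact K \<and> K \<subseteq> {0..} \<times> UNIV \<and> 0 < e}"

section \<open>The hitting time\<close>

text \<open>In \<^typ>\<open>ennreal\<close> the infimum of the empty set is \<open>\<infinity>\<close>.\<close>

definition hitting_time :: "(real \<Rightarrow> 'a) \<times> (real \<times> 'a \<Rightarrow> real) \<Rightarrow> ennreal" where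
  "hitting_time = (\<lambda>(x, F). Inf {ennreal t | t. 0 \<le> t \<and> F (t, x t) \<ge> 0})"

section \<open>Well-formedness of the topologies\<close>

lemma time_changesE:
  assumes "l \<in> time_changes T"
  obtains g where "g \<in> time_changes T" "homeomorphism {0..T} {0..T} l g"
proof -
  obtain g where g: "homeomorphism {0..T} {0..T} l g" and l: "strict_mono_on {0..T} l"
    using assms by (auto simp: time_changes_def)
  have "strict_mono_on {0..T} g"
  proof (rule strict_mono_onI)
    fix r s assume rs: "r \<in> {0..T}" "s \<in> {0..T}" "r < s"
    have m: "g r \<in> {0..T}" "g s \<in> {0..T}" "l (g r) = r" "l (g s) = s"
      using g rs unfolding homeomorphism_def by auto
    show "g r < g s"
    proof (rule ccontr)
      assume "\<not> g r < g s"
      then have "l (g s) \<le> l (g r)"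
        using m l by (metis leD linorder_neqE_linordered_idom not_le strict_mono_onD order_refl le_less)
      with m rs show False by simp
    qed
  qed
  then have "g \<in> time_changes T"
    using homeomorphism_symD[OF g] unfolding time_changes_def by blast
  with g that show thesis by blast
qed

lemma time_changes_mem: "l \<in> time_changes T \<Longrightarrow> t \<in> {0..T} \<Longrightarrow> l t \<in> {0..T}"
  unfolding time_changes_def homeomorphism_def by blast

lemma time_changes_less:
  "l \<in> time_changes T \<Longrightarrow> s \<in> {0..T} \<Longrightarrow> t \<in> {0..T} \<Longrightarrow> s < t \<Longrightarrow> l s < l t"
  unfolding time_changes_def by (blast dest: strict_mono_onD)

lemma time_changes_compose:
  assumes "l \<in> time_changes T" "k \<in> time_changes T"
  shows "k \<circ> l \<in> time_changes T"
proof -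
  have "strict_mono_on {0..T} (k \<circ> l)"
  proof (rule strict_mono_onI)
    fix r s assume rs: "r \<in> {0..T}" "s \<in> {0..T}" "r < s"
    then have "l r < l s" using assms(1) time_changes_less by blast
    then show "(k \<circ> l) r < (k \<circ> l) s"
      using rs time_changes_mem[OF assms(1)] time_changes_less[OF assms(2)] by auto
  qed
  with assms show ?thesis
    by (auto simp: time_changes_def intro: homeomorphism_compose)
qed

lemma time_changes_id: "(\<lambda>t. t) \<in> time_changes T"
  by (auto simp: time_changes_def homeomorphism_def strict_mono_on_def intro!: exI[of _ "\<lambda>t. t"])

lemma time_changes_end:
  assumes "l \<in> time_changes T" "0 < T"
  shows "l T = T"
proof (rule ccontr)
  assume ne: "l T \<noteq> T"
  obtain g where "homeomorphism {0..T} {0..T} l g" using assms by (auto simp: time_changes_def)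
  then have "T \<in> l ` {0..T}" using assms unfolding homeomorphism_def by auto
  then obtain s where s: "s \<in> {0..T}" "l s = T" by auto
  with ne have "s < T" by (cases "s = T") auto
  then have "l s < l T" using time_changes_less[OF assms(1) s(1), of T] assms(2) by auto
  moreover have "l T \<le> T" using time_changes_mem[OF assms(1), of T] assms by auto
  ultimately show False using s by simp
qed

lemma bdd_above_time_change:
  assumes "l \<in> time_changes T"
  shows "bdd_above ((\<lambda>t. \<bar>l t - t\<bar>) ` {0..T})"
  using time_changes_mem[OF assms] by (fastforce intro!: bdd_aboveI2[where M = T])

lemma cadlag_on_bounded:
  fixes x :: "real \<Rightarrow> 'a::metric_space"
  assumes "cadlag_on {a..b} x"
  shows "bounded (x ` {a..b})"
proof -
  let ?I = "{a..b}"
  have "\<exists>U. open U \<and> t \<in> U \<and> bounded (x ` (?I \<inter> U))" if t: "t \<in> ?I" for t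
  proof -
    obtain l where "(x \<longlongrightarrow> x t) (at t within ?I \<inter> {t<..})" and "(x \<longlongrightarrow> l) (at t within ?I \<inter> {..<t})"
      using assms t unfolding cadlag_on_def by blast
    then have "eventually (\<lambda>s. dist (x s) (x t) < 1) (at t within ?I \<inter> {t<..})"
      and "eventually (\<lambda>s. dist (x s) l < 1) (at t within ?I \<inter> {..<t})"
      by (auto dest: tendstoD[where e = 1])
    then obtain d1 d2 where d: "d1 > 0" "d2 > 0"
      "\<And>s. s \<in> ?I \<Longrightarrow> t < s \<Longrightarrow> dist s t < d1 \<Longrightarrow> dist (x s) (x t) < 1"
      "\<And>s. s \<in> ?I \<Longrightarrow> s < t \<Longrightarrow> dist s t < d2 \<Longrightarrow> dist (x s) l < 1"
      unfolding eventually_at by (metis Int_iff greaterThan_iff lessThan_iff less_irrefl)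
    have "x ` (?I \<inter> ball t (min d1 d2)) \<subseteq> ball (x t) 1 \<union> ball l 1"
    proof
      fix z assume "z \<in> x ` (?I \<inter> ball t (min d1 d2))"
      then obtain s where s: "s \<in> ?I" "dist s t < d1" "dist s t < d2" "z = x s"
        by (auto simp: dist_commute)
      then consider "s = t" | "dist z (x t) < 1" | "dist z l < 1"
        using d by (cases s t rule: linorder_cases) auto
      then show "z \<in> ball (x t) 1 \<union> ball l 1"
        using s by cases (auto simp: dist_commute)
    qed
    then have "bounded (x ` (?I \<inter> ball t (min d1 d2)))"
      using bounded_subset bounded_Un bounded_ball by metis
    then show ?thesis using d by (intro exI[of _ "ball t (min d1 d2)"]) auto
  qed
  then obtain U where U: "\<And>t. t \<in> ?I \<Longrightarrow> open (U t) \<and> t \<in> U t \<and> bounded (x ` (?I \<inter> U t))"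
    by metis
  obtain C where C: "C \<subseteq> ?I" "finite C" "?I \<subseteq> (\<Union>c\<in>C. U c)"
    using compactE_image[OF compact_Icc[of a b], of ?I U] U by blast
  have "bounded (\<Union>c\<in>C. x ` (?I \<inter> U c))" using C U by (intro bounded_UN) auto
  moreover have "x ` ?I \<subseteq> (\<Union>c\<in>C. x ` (?I \<inter> U c))" using C by blast
  ultimately show ?thesis using bounded_subset by blast
qed

lemma bdd_above_J1:
  assumes "x \<in> cadlag_paths {0..T}" "y \<in> cadlag_paths {0..T}" "l \<in> time_changes T"
  shows "bdd_above ((\<lambda>t. dist (x t) (y (l t))) ` {0..T})"
proof -
  have "bounded (x ` {0..T} \<union> y ` {0..T})"
    using assms cadlag_on_bounded by (auto simp: cadlag_paths_def)
  then obtain e where e: "\<And>u v. u \<in> x ` {0..T} \<union> y ` {0..T} \<Longrightarrow> v \<in> x ` {0..T} \<union> y ` {0..T} \<Longrightarrow> dist u v \<le> e"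
    unfolding bounded_two_points by blast
  show ?thesis
    using time_changes_mem[OF assms(3)] by (intro bdd_aboveI2[where M = e] e) auto
qed

lemma J1_cost_le_iff:
  assumes "0 < T" "x \<in> cadlag_paths {0..T}" "y \<in> cadlag_paths {0..T}" "l \<in> time_changes T"
  shows "J1_cost T x y l \<le> c \<longleftrightarrow> (\<forall>t\<in>{0..T}. \<bar>l t - t\<bar> \<le> c \<and> dist (x t) (y (l t)) \<le> c)"
proof -
  have ne: "{0..T} \<noteq> {}" using assms by auto
  show ?thesis
    unfolding J1_cost_def max.bounded_iff cSUP_le_iff[OF ne bdd_above_time_change[OF assms(4)]]
      cSUP_le_iff[OF ne bdd_above_J1[OF assms(2-4)]] by blast
qed

lemma J1_cost_nonneg:
  assumes "0 < T" "l \<in> time_changes T"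
  shows "0 \<le> J1_cost T x y l"
proof -
  have "\<bar>l 0 - 0\<bar> \<le> (SUP t\<in>{0..T}. \<bar>l t - t\<bar>)"
    using assms by (intro cSUP_upper bdd_above_time_change) auto
  then show ?thesis unfolding J1_cost_def by linarith
qed

lemma J1_dist_le:
  assumes "0 < T" "l \<in> time_changes T"
  shows "J1_dist T x y \<le> J1_cost T x y l"
  unfolding J1_dist_def
  by (rule cINF_lower[OF _ assms(2)]) (use J1_cost_nonneg[OF assms(1)] in \<open>auto intro!: bdd_belowI2\<close>)

lemma J1_dist_nonneg: "0 < T \<Longrightarrow> 0 \<le> J1_dist T x y"
  unfolding J1_dist_def 
  using time_changes_id J1_cost_nonneg by (intro cINF_greatest) blast+

lemma J1_dist_lessE:
  assumes "0 < T" "J1_dist T x y < c"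
  obtains l where "l \<in> time_changes T" "J1_cost T x y l < c"
  using assms time_changes_id[of T] unfolding J1_dist_def
  by (metis (no_types, lifting) cInf_lessD empty_iff imageE image_is_empty)

lemma J1_dist_commute_le:
  assumes "0 < T"
  shows "J1_dist T x y \<le> J1_dist T y x"
  unfolding J1_dist_def[of T y x]
proof (rule cINF_greatest)
  show "time_changes T \<noteq> {}" using time_changes_id by blast
  fix l assume "l \<in> time_changes T"
  then obtain g where g: "g \<in> time_changes T" "homeomorphism {0..T} {0..T} l g"
    by (rule time_changesE)
  have im: "g ` {0..T} = {0..T}" and lg: "\<And>t. t \<in> {0..T} \<Longrightarrow> l (g t) = t"
    using g unfolding homeomorphism_def by auto
  have 1: "(\<lambda>t. \<bar>l t - t\<bar>) ` {0..T} = (\<lambda>t. \<bar>g t - t\<bar>) ` {0..T}"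
    by (subst im[symmetric], unfold image_image, rule image_cong) (auto simp: lg)
  have 2: "(\<lambda>t. dist (y t) (x (l t))) ` {0..T} = (\<lambda>t. dist (x t) (y (g t))) ` {0..T}"
    by (subst im[symmetric], unfold image_image, rule image_cong) (auto simp: lg dist_commute)
  have "J1_cost T y x l = J1_cost T x y g" unfolding J1_cost_def 1 2 ..
  with J1_dist_le[OF assms g(1)] show "J1_dist T x y \<le> J1_cost T y x l" by metis
qed

lemma J1_dist_eq_0D:
  assumes T: "0 < T" and x: "x \<in> cadlag_paths {0..T}" and y: "y \<in> cadlag_paths {0..T}"
    and 0: "J1_dist T x y = 0"
  shows "x = y"
proof (rule extensionalityI[where A = "{0..T}"])
  show "x \<in> extensional {0..T}" "y \<in> extensional {0..T}" using x y by (auto simp: cadlag_paths_def)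
  fix t assume t: "t \<in> {0..T}"
  have cl: "\<exists>l\<in>time_changes T. \<forall>s\<in>{0..T}. \<bar>l s - s\<bar> \<le> c \<and> dist (x s) (y (l s)) \<le> c" if "c > 0" for c
    using J1_dist_lessE[OF T, of x y c] 0 that J1_cost_le_iff[OF T x y] by (metis less_imp_le)
  have "dist (x t) (y t) \<le> 3 * e" if e: "e > 0" for e
  proof (cases "t = T")
    case True
    then show ?thesis using cl[OF e] time_changes_end[OF _ T] t e by force
  next
    case False
    then have tT: "t < T" using t by auto
    have "eventually (\<lambda>s. dist (x s) (x t) < e) (at t within {0..T} \<inter> {t<..})"
      "eventually (\<lambda>s. dist (y s) (y t) < e) (at t within {0..T} \<inter> {t<..})"
      using x y t e by (auto simp: cadlag_paths_def cadlag_on_def intro!: tendstoD)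
    then have "eventually (\<lambda>s. dist (x s) (x t) < e \<and> dist (y s) (y t) < e) (at t within {0..T} \<inter> {t<..})"
      by (rule eventually_conj)
    then obtain d where d: "d > 0"
      "\<And>s. s \<in> {0..T} \<Longrightarrow> t < s \<Longrightarrow> dist s t < d \<Longrightarrow> dist (x s) (x t) < e \<and> dist (y s) (y t) < e"
      unfolding eventually_at by (metis Int_iff greaterThan_iff less_irrefl)
    define h where "h = min d (T - t)"
    have h: "h > 0" "h \<le> d" "t + h \<le> T" using d tT by (auto simp: h_def)
    obtain l where l: "l \<in> time_changes T"
      "\<And>s. s \<in> {0..T} \<Longrightarrow> \<bar>l s - s\<bar> \<le> min e (h/4) \<and> dist (x s) (y (l s)) \<le> min e (h/4)"
      using cl[of "min e (h/4)"] e h by auto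
    define s where "s = t + h/2"
    have s: "s \<in> {0..T}" "t < s" "dist s t < d" using h t d by (auto simp: s_def dist_real_def)
    have ls: "\<bar>l s - s\<bar> \<le> h/4" "dist (x s) (y (l s)) \<le> e" using l(2)[OF s(1)] by auto
    have "t < l s" "dist (l s) t < d" "l s \<in> {0..T}"
      using ls(1) h t by (auto simp: s_def dist_real_def abs_if split: if_splits)
    with d(2) s have "dist (x s) (x t) < e" "dist (y (l s)) (y t) < e" by auto
    moreover have "dist (x t) (y t) \<le> dist (x s) (x t) + dist (x s) (y (l s)) + dist (y (l s)) (y t)"
      by (metis add.commute dist_commute dist_triangle dist_triangle_le add_mono order_refl add_right_mono order_trans)
    ultimately show ?thesis using ls by linarith
  qed
  from this[of "dist (x t) (y t) / 6"] show "x t = y t"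
    by (cases "x t = y t") auto
qed

lemma J1_dist_triangle:
  assumes T: "0 < T" and x: "x \<in> cadlag_paths {0..T}" and y: "y \<in> cadlag_paths {0..T}"
    and z: "z \<in> cadlag_paths {0..T}"
  shows "J1_dist T x z \<le> J1_dist T x y + J1_dist T y z"
proof (rule field_le_epsilon)
  fix e :: real assume e: "e > 0"
  obtain l where l: "l \<in> time_changes T" "J1_cost T x y l < J1_dist T x y + e/2"
    using J1_dist_lessE[OF T, of x y "J1_dist T x y + e/2"] e by auto
  obtain k where k: "k \<in> time_changes T" "J1_cost T y z k < J1_dist T y z + e/2"
    using J1_dist_lessE[OF T, of y z "J1_dist T y z + e/2"] e by auto
  let ?c = "J1_cost T x y l + J1_cost T y z k"
  have "J1_cost T x z (k \<circ> l) \<le> ?c"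
    unfolding J1_cost_le_iff[OF T x z time_changes_compose[OF l(1) k(1)]]
  proof
    fix t assume t: "t \<in> {0..T}"
    have a: "\<bar>l t - t\<bar> \<le> J1_cost T x y l" "dist (x t) (y (l t)) \<le> J1_cost T x y l"
      using J1_cost_le_iff[OF T x y l(1), of "J1_cost T x y l"] t by auto
    have b: "\<bar>k (l t) - l t\<bar> \<le> J1_cost T y z k" "dist (y (l t)) (z (k (l t))) \<le> J1_cost T y z k"
      using J1_cost_le_iff[OF T y z k(1), of "J1_cost T y z k"] time_changes_mem[OF l(1) t] by auto
    show "\<bar>(k \<circ> l) t - t\<bar> \<le> ?c \<and> dist (x t) (z ((k \<circ> l) t)) \<le> ?c"
      using a b dist_triangle[of "x t" "z (k (l t))" "y (l t)"] by auto
  qed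
  with J1_dist_le[OF T time_changes_compose[OF l(1) k(1)], of x z] l k
  show "J1_dist T x z \<le> J1_dist T x y + J1_dist T y z + e" by linarith
qed

lemma Metric_space_J1:
  assumes T: "0 < T"
  shows "Metric_space (cadlag_paths {0..T}) (J1_dist T)"
proof
  show "0 \<le> J1_dist T x y" for x y :: "real \<Rightarrow> 'a" by (rule J1_dist_nonneg[OF T])
  show "J1_dist T x y = J1_dist T y x" for x y :: "real \<Rightarrow> 'a"
    using J1_dist_commute_le[OF T] by (rule order_antisym) (rule J1_dist_commute_le[OF T])
  show "J1_dist T x y = 0 \<longleftrightarrow> x = y"
    if xy: "x \<in> cadlag_paths {0..T}" "y \<in> cadlag_paths {0..T}" for x y :: "real \<Rightarrow> 'a"
  proof
    assume "x = y"
    then have "J1_cost T x y (\<lambda>t. t) \<le> 0"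
      using J1_cost_le_iff[OF T xy time_changes_id] by simp
    then show "J1_dist T x y = 0"
      using J1_dist_le[OF T time_changes_id, of x y] J1_dist_nonneg[OF T, of x y] by simp
  qed (rule J1_dist_eq_0D[OF T xy])
  show "J1_dist T x z \<le> J1_dist T x y + J1_dist T y z"
    if "x \<in> cadlag_paths {0..T}" "y \<in> cadlag_paths {0..T}" "z \<in> cadlag_paths {0..T}"
    for x y z :: "real \<Rightarrow> 'a"
    using J1_dist_triangle[OF T that] .
qed

lemma topspace_J1_topology: "0 < T \<Longrightarrow> topspace (J1_topology T) = cadlag_paths {0..T}"
  unfolding J1_topology_def by (rule Metric_space.topspace_mtopology[OF Metric_space_J1])

lemma cadlag_on_restrict:
  assumes "cadlag_on I x" "J \<subseteq> I"
  shows "cadlag_on J (restrict x J)"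
  unfolding cadlag_on_def
proof
  fix t assume t: "t \<in> J"
  have ev: "eventually (\<lambda>s. x s = restrict x J s) (at t within J \<inter> A)" for A
    by (simp add: eventually_at_filter)
  have tI: "t \<in> I" using t assms(2) by blast
  have right: "(x \<longlongrightarrow> x t) (at t within I \<inter> {t<..})"
    using assms(1) tI unfolding cadlag_on_def by blast
  obtain l where left: "(x \<longlongrightarrow> l) (at t within I \<inter> {..<t})"
    using assms(1) tI unfolding cadlag_on_def by blast
  have sub: "J \<inter> A \<subseteq> I \<inter> A" for A using assms(2) by blast
  have 1: "(restrict x J \<longlongrightarrow> x t) (at t within J \<inter> {t<..})"
    by (rule Lim_transform_eventually[OF tendsto_within_subset[OF right sub] ev])
  have 2: "(restrict x J \<longlongrightarrow> l) (at t within J \<inter> {..<t})"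
    by (rule Lim_transform_eventually[OF tendsto_within_subset[OF left sub] ev])
  have 3: "restrict x J t = x t" using t by simp
  show "(restrict x J \<longlongrightarrow> restrict x J t) (at t within J \<inter> {t<..}) \<and>
        (\<exists>l. (restrict x J \<longlongrightarrow> l) (at t within J \<inter> {..<t}))"
    unfolding 3 using 1 2 by blast
qed

lemma restrict_cadlag_paths:
  assumes "x \<in> cadlag_paths {0..}"
  shows "restrict x {0..T} \<in> cadlag_paths {0..T}"
  using assms cadlag_on_restrict[of "{0..}" x "{0..T}"] by (simp add: cadlag_paths_def subset_iff)

lemma topspace_local_J1_topology: "topspace local_J1_topology = cadlag_paths {0..}"
proof
  show "topspace local_J1_topology \<subseteq> (cadlag_paths {0..} :: (real \<Rightarrow> 'a) set)"
    unfolding local_J1_topology_def topology_generated_by_topspace by blast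
  show "(cadlag_paths {0..} :: (real \<Rightarrow> 'a) set) \<subseteq> topspace local_J1_topology"
  proof
    fix x :: "real \<Rightarrow> 'a" assume x: "x \<in> cadlag_paths {0..}"
    let ?U = "topspace (J1_topology 1) :: (real \<Rightarrow> 'a) set"
    have "restrict x {0..1} \<in> ?U"
      using restrict_cadlag_paths[OF x] by (simp add: topspace_J1_topology)
    then have "x \<in> {x \<in> cadlag_paths {0..}. restrict x {0..1} \<in> ?U}" using x by simp
    moreover have "(0::real) < 1" "openin (J1_topology 1) ?U" by simp_all
    ultimately show "x \<in> topspace local_J1_topology"
      unfolding local_J1_topology_def topology_generated_by_topspace by blast
  qed
qed

lemma topspace_ucc_topology: "topspace ucc_topology = cont_funs"
proof
  show "topspace ucc_topology \<subseteq> (cont_funs :: (real \<times> 'a \<Rightarrow> real) set)"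
    unfolding ucc_topology_def topology_generated_by_topspace by blast
  show "(cont_funs :: (real \<times> 'a \<Rightarrow> real) set) \<subseteq> topspace ucc_topology"
  proof
    fix F :: "real \<times> 'a \<Rightarrow> real" assume F: "F \<in> cont_funs"
    then have "cont_funs = {G \<in> cont_funs. \<forall>p\<in>{}. \<bar>G p - F p\<bar> < 1}" by simp
    with F show "F \<in> topspace ucc_topology"
      unfolding ucc_topology_def topology_generated_by_topspace
      by (intro UnionI[of cont_funs] CollectI exI[of _ F] exI[of _ "{}"] exI[of _ "1::real"]) auto
  qed
qed

end

theory Submission
  imports Defs
begin

text \<open>
  It suffices to perturb \<open>\<Phi>\<close> by constants. If \<open>y \<le> 0\<close> on \<open>[\<tau>, \<tau> + \<epsilon>]\<close>, then for every \<open>c > 0\<close> the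
  hitting time of \<open>(x, \<Phi> - c)\<close> is at least \<open>\<tau> + \<epsilon>\<close>. If \<open>y < 0\<close> has supremum \<open>0\<close> on \<open>[0, T]\<close>, then
  for every \<open>c > 0\<close> the hitting time of \<open>(x, \<Phi> + c)\<close> is at most \<open>T\<close>.
\<close>

text \<open>Restricting to the domain keeps the perturbed function \<open>undefined\<close>
  elsewhere, so that it can lie in the carrier \<open>cont_funs\<close>.\<close>

definition shift :: "(real \<times> 'a \<Rightarrow> real) \<Rightarrow> real \<Rightarrow> real \<times> 'a \<Rightarrow> real" where
  "shift F c = (\<lambda>p\<in>{0..} \<times> UNIV. F p + c)"

lemma shift_apply: "0 \<le> t \<Longrightarrow> shift F c (t, u) = F (t, u) + c"
  by (simp add: shift_def)

lemma shift_0: "F \<in> cont_funs \<Longrightarrow> shift F 0 = F"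
  unfolding shift_def cont_funs_def by (auto simp: extensional_def restrict_def fun_eq_iff)

lemma shift_in_cont_funs:
  assumes "F \<in> cont_funs"
  shows "shift F c \<in> cont_funs"
proof -
  have "continuous_on ({0..} \<times> UNIV) (\<lambda>p. F p + c)"
    using assms by (simp add: cont_funs_def continuous_on_add)
  then have "continuous_on ({0..} \<times> UNIV) (shift F c)"
    unfolding shift_def by (rule continuous_on_eq) simp
  then show ?thesis by (simp add: cont_funs_def shift_def)
qed

text \<open>It is enough to treat the generating sets. On a compact \<open>K\<close> the deviation
  from the centre \<open>H\<close> attains its maximum, which stays strictly below \<open>e\<close>;
  the constant can then move by the remaining slack.\<close>

lemma continuous_map_shift:
  fixes F :: "real \<times> 'a::metric_space \<Rightarrow> real"
  assumes F: "F \<in> cont_funs"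
  shows "continuous_map euclideanreal ucc_topology (shift F)"
  unfolding ucc_topology_def
proof (rule continuous_on_generated_topo)
  fix U :: "(real \<times> 'a \<Rightarrow> real) set"
  assume "U \<in> {{G \<in> cont_funs. \<forall>p\<in>K. \<bar>G p - H p\<bar> < e} | H K e.
          H \<in> cont_funs \<and> compact K \<and> K \<subseteq> {0..} \<times> UNIV \<and> 0 < e}"
  then obtain H K e where U: "U = {G \<in> cont_funs. \<forall>p\<in>K. \<bar>G p - H p\<bar> < e}"
    and H: "H \<in> cont_funs" and K: "compact K" "K \<subseteq> {0..} \<times> UNIV" and e: "0 < e" by blast
  have "\<exists>d>0. \<forall>b. dist b c < d \<longrightarrow> shift F b \<in> U" if c: "shift F c \<in> U" for c
  \<comment> \<open>The empty set is split off because the maximum over \<open>K\<close> exists only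
    for nonempty \<open>K\<close>.\<close>
  proof (cases "K = {}")
    case True
    then show ?thesis using shift_in_cont_funs[OF F] U by (auto intro!: exI[of _ 1])
  next
    case False
    have "continuous_on K (shift F c)" "continuous_on K H"
      using shift_in_cont_funs[OF F, of c] H K(2)
      by (auto simp: cont_funs_def intro: continuous_on_subset)
    then have "continuous_on K (\<lambda>p. \<bar>shift F c p - H p\<bar>)" by (intro continuous_intros)
    then obtain q where q: "q \<in> K" "\<And>p. p \<in> K \<Longrightarrow> \<bar>shift F c p - H p\<bar> \<le> \<bar>shift F c q - H q\<bar>"
      using continuous_attains_sup[OF K(1) False] by blast
    \<comment> \<open>This slack is uniform in \<open>p\<close>, since changing \<open>c\<close> to
      \<open>b\<close> moves every value by the same amount \<open>b - c\<close>.\<close>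
    define d where "d = e - \<bar>shift F c q - H q\<bar>"
    have "d > 0" using c q(1) by (auto simp: U d_def)
    moreover have "shift F b \<in> U" if b: "dist b c < d" for b
    proof -
      have "\<bar>shift F b p - H p\<bar> < e" if p: "p \<in> K" for p
      proof -
        have "shift F b p = shift F c p + (b - c)"
          using p K(2) by (auto simp: shift_def)
        then show ?thesis using q(2)[OF p] b by (simp add: d_def dist_real_def)
      qed
      then show ?thesis using shift_in_cont_funs[OF F] by (simp add: U)
    qed
    ultimately show ?thesis by blast
  qed
  then have "open (shift F -` U)" by (auto simp: open_dist)
  then show "openin euclideanreal (shift F -` U \<inter> topspace euclideanreal)" by simp
next
  show "shift F ` topspace euclideanreal
      \<subseteq> \<Union> {{G \<in> cont_funs. \<forall>p\<in>K. \<bar>G p - H p\<bar> < e} | H K e.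
          H \<in> cont_funs \<and> compact K \<and> K \<subseteq> {0..} \<times> UNIV \<and> 0 < e}"
    \<comment> \<open>The union of the generators is the topspace, already identified with
      \<open>cont_funs\<close>.\<close>
    unfolding topology_generated_by_topspace[symmetric] ucc_topology_def[symmetric]
      topspace_ucc_topology
    using shift_in_cont_funs[OF F] by blast
qed

text \<open>Continuity is pulled back along the curve \<open>c \<mapsto> (x, shift F c)\<close>,
  which passes through \<open>(x, F)\<close> at \<open>c = 0\<close>. Both parts of the theorem
  refute this conclusion for a suitable \<open>V\<close>.\<close>

lemma topcontinuous_at_shift:
  fixes x :: "real \<Rightarrow> 'a::metric_space"
  assumes x: "x \<in> cadlag_paths {0..}" and F: "F \<in> cont_funs"
    and cont: "topcontinuous_at (prod_topology local_J1_topology ucc_topology)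
                 euclidean hitting_time (x, F)"
    and V: "open V" "hitting_time (x, F) \<in> V"
  obtains e where "e > 0" "\<And>c. \<bar>c\<bar> < e \<Longrightarrow> hitting_time (x, shift F c) \<in> V"
proof -
  let ?P = "prod_topology (local_J1_topology :: (real \<Rightarrow> 'a) topology) ucc_topology"
  obtain U where U: "openin ?P U" "(x, F) \<in> U" "\<And>z. z \<in> U \<Longrightarrow> hitting_time z \<in> V"
  proof -
    have "openin euclidean V" using V(1) by simp
    with cont V(2) have "\<exists>U. openin ?P U \<and> (x, F) \<in> U \<and> (\<forall>z\<in>U. hitting_time z \<in> V)"
      unfolding topcontinuous_at_def by simp
    then show thesis using that by blast
  qed
  have "continuous_map euclideanreal ?P (\<lambda>c. (x, shift F c))"
    using x continuous_map_shift[OF F]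
    by (simp add: continuous_map_pairwise o_def topspace_local_J1_topology)
  from openin_continuous_map_preimage[OF this U(1)]
  have "open {c. (x, shift F c) \<in> U}" by simp
  moreover have "0 \<in> {c. (x, shift F c) \<in> U}" using U(2) F by (simp add: shift_0)
  ultimately obtain e where "e > 0" "ball 0 e \<subseteq> {c. (x, shift F c) \<in> U}"
    using open_contains_ball by blast
  with U(3) show thesis by (intro that[of e]) (auto simp: subset_iff)
qed

lemma hitting_time_le: "0 \<le> t \<Longrightarrow> F (t, x t) \<ge> 0 \<Longrightarrow> hitting_time (x, F) \<le> ennreal t"
  unfolding hitting_time_def by (auto intro!: Inf_lower)

lemma hitting_time_ge:
  assumes "\<And>t. 0 \<le> t \<Longrightarrow> t < r \<Longrightarrow> F (t, x t) < 0"
  shows "ennreal r \<le> hitting_time (x, F)"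
  unfolding hitting_time_def using assms by (fastforce intro!: Inf_greatest ennreal_leI)

theorem proposition3p2:
  fixes x :: "real \<Rightarrow> real ^ 'd" and \<Phi> :: "real \<times> (real ^ 'd) \<Rightarrow> real"
    and y :: "real \<Rightarrow> real" and \<tau> :: ennreal
  assumes "x \<in> cadlag_paths {0..}" and "\<Phi> \<in> cont_funs"
    and "\<And>t. 0 \<le> t \<Longrightarrow> y t = \<Phi> (t, x t)" and "\<tau> = hitting_time (x, \<Phi>)"
  shows "(\<tau> < \<infinity> \<and>
            \<not> (\<forall>\<epsilon>>0. (SUP s\<in>{enn2real \<tau> .. enn2real \<tau> + \<epsilon>}. ereal (y s)) > 0)
          \<longrightarrow> \<not> topcontinuous_at (prod_topology local_J1_topology ucc_topology)
                  euclidean hitting_time (x, \<Phi>))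
       \<and> (\<tau> = \<infinity> \<and> (\<exists>T>0. (SUP s\<in>{0..T}. ereal (y s)) = 0)
          \<longrightarrow> \<not> topcontinuous_at (prod_topology local_J1_topology ucc_topology)
                  euclidean hitting_time (x, \<Phi>))"
proof (intro conjI impI notI)
  assume A: "\<tau> < \<infinity> \<and> \<not> (\<forall>\<epsilon>>0. (SUP s\<in>{enn2real \<tau> .. enn2real \<tau> + \<epsilon>}. ereal (y s)) > 0)"
    and C: "topcontinuous_at (prod_topology local_J1_topology ucc_topology)
              euclidean hitting_time (x, \<Phi>)"
  define r where "r = enn2real \<tau>"
  have r: "0 \<le> r" "\<tau> = ennreal r" using A by (auto simp: r_def)
  obtain \<epsilon> where e: "\<epsilon> > 0" "(SUP s\<in>{r..r + \<epsilon>}. ereal (y s)) \<le> 0"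
    using A by (auto simp: r_def not_less)
  \<comment> \<open>Before \<open>r\<close> this is minimality of the hitting time; from
    \<open>r\<close> on it is the choice of \<open>\<epsilon>\<close>.\<close>
  have y: "y s \<le> 0" if "0 \<le> s" "s \<le> r + \<epsilon>" for s
  proof (cases "s < r")
    case True
    have "\<not> ennreal r \<le> ennreal s" using True that by (simp add: ennreal_le_iff2)
    then show ?thesis
      using hitting_time_le[of s \<Phi> x] that assms(3)[of s] assms(4) r by force
  next
    case False
    then have "ereal (y s) \<le> 0" using e(2) that by (simp add: SUP_le_iff)
    then show ?thesis by simp
  qed
  have "hitting_time (x, \<Phi>) \<in> {..<ennreal (r + \<epsilon>)}"
    unfolding assms(4)[symmetric] r(2) using r(1) e(1) by (simp add: ennreal_less_iff)
  then obtain d where d: "d > 0"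
    "\<And>c. \<bar>c\<bar> < d \<Longrightarrow> hitting_time (x, shift \<Phi> c) \<in> {..<ennreal (r + \<epsilon>)}"
    using topcontinuous_at_shift[OF assms(1,2) C open_lessThan] by metis
  \<comment> \<open>The shift \<open>- d / 2\<close> is small enough for \<open>d\<close> and turns
    \<open>y \<le> 0\<close> into a strict inequality, so hitting is delayed out of the chosen
    neighbourhood of \<open>\<tau>\<close>.\<close>
  have "ennreal (r + \<epsilon>) \<le> hitting_time (x, shift \<Phi> (- d / 2))"
  proof (rule hitting_time_ge)
    fix t assume "0 \<le> t" "t < r + \<epsilon>"
    then show "shift \<Phi> (- d / 2) (t, x t) < 0"
      using y[of t] assms(3)[of t] d(1) by (simp add: shift_apply)
  qed
  with d(2)[of "- d / 2"] d(1) show False by auto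
next
  assume A: "\<tau> = \<infinity> \<and> (\<exists>T>0. (SUP s\<in>{0..T}. ereal (y s)) = 0)"
    and C: "topcontinuous_at (prod_topology local_J1_topology ucc_topology)
              euclidean hitting_time (x, \<Phi>)"
  then obtain T where T: "T > 0" "(SUP s\<in>{0..T}. ereal (y s)) = 0" by blast
  \<comment> \<open>This is an open neighbourhood of \<open>\<infinity>\<close> that excludes all
    hitting times up to \<open>T\<close>.\<close>
  have "hitting_time (x, \<Phi>) \<in> {ennreal T<..}" using A assms(4) by simp
  then obtain d where d: "d > 0"
    "\<And>c. \<bar>c\<bar> < d \<Longrightarrow> hitting_time (x, shift \<Phi> c) \<in> {ennreal T<..}"
    using topcontinuous_at_shift[OF assms(1,2) C open_greaterThan] by metis
  \<comment> \<open>The supremum need not be attained, but some \<open>y s\<close> comes within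
    \<open>d / 2\<close> of it, and raising \<open>\<Phi>\<close> by \<open>d / 2\<close> then makes
    \<open>s\<close> a hitting point.\<close>
  have "ereal (- d / 2) < (SUP s\<in>{0..T}. ereal (y s))" using T(2) d(1) by simp
  then obtain s where s: "s \<in> {0..T}" "- d / 2 < y s" unfolding less_SUP_iff by auto
  have "hitting_time (x, shift \<Phi> (d / 2)) \<le> ennreal s"
    using s assms(3)[of s] by (intro hitting_time_le) (auto simp: shift_apply)
  also have "\<dots> \<le> ennreal T" using s by (intro ennreal_leI) simp
  finally show False using d(2)[of "d / 2"] d(1) by auto
qed

end
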